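(* Let $d\ge 0$, $n>2$ and $0\le k\le d$ be integers, let $p\in[0,1]$ and $q=1-p$, and let $C$ be the random cubical complex of the $d$-dimensional voxel model with parameters $n$ and $p$. The variance of $\mu_k(C)$, normalized by volume, is a polynomial in $q$ of degree $2^{d-k+1}$, as follows: $$V_{d,k}(q)=\frac{1}{n^d}\mathrm{Var}(\mu_k(C))=\sum_{i=0}^d\sum_{j=0}^d\sum_{s=0}^d(-1)^{i+j}\binom{i}{k}\binom{j}{k}\binom{d}{s}N_{i,j,s}\,q^{2^{d-i}+2^{d-j}}\left(q^{-2^{d-s}}-1\right),$$ where $$N_{i,j,s}=\sum_{\ell=0}^s(-1)^{s-\ell}\binom{s}{\ell}\binom{\ell}{i}\binom{\ell}{j}2^{s+\ell-i-j}.$$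
   Context: The lattice $\mathcal{L}$ is the $d$-dimensional torus $(\mathbb{R}/n\mathbb{Z})^d$ subdivided into $n^d$ unit $d$-cubes. An open $i$-cube of $\mathcal{L}$ ($0\le i\le d$) is a product of $d$ factors, each of which is either a point $\{a\}$ or an open unit interval $(a,a+1)$ with $a\in\mathbb{Z}/n\mathbb{Z}$, with exactly $i$ factors being intervals; $\mathcal{L}$ is the disjoint union of its open cubes. An open cube $X$ is a face of a cube $Y$ if $X$ is contained in the closure of $Y$ (each cube is a face of itself). Intrinsic volumes: an open $i$-cube has $k$-th intrinsic volume $(-1)^{i-k}\binom{i}{k}$ (which is $0$ if $k>i$), and if $C$ is a union of open cubes of $\mathcal{L}$ then $\mu_k(C)$ is the sum of the $k$-th intrinsic volumes of the open cubes contained in $C$. Voxel model: the $d$-cubes of $\mathcal{L}$ are selected independently, each with probability $p$; $C$ is the union of the closures of the selected $d$-cubes. Equivalently, an open $i$-cube with $i<d$ belongs to $C$ exactly when it is a face of a selected $d$-cube. Conventions: $\binom{a}{b}=0$ if $b>a\ge 0$. Products of powers of $q$ in the formula are read as the expanded monomials $q^{2^{d-i}+2^{d-j}-2^{d-s}}-q^{2^{d-i}+2^{d-j}}$, and terms with $N_{i,j,s}=0$ (in particular all those with $s<\max(i,j)$) are read as $0$, so the expression is a polynomial. *)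

theory Defs
  imports "HOL-Probability.Probability" "HOL-Computational_Algebra.Polynomial"
begin

definition circle_rel :: "nat \<Rightarrow> (real \<times> real) set" where
  "circle_rel n = {(x, y). \<exists>m::int. y - x = of_int m * real n}"

text \<open>The circle \<open>\<real>/n\<int>\<close>: its points are the equivalence classes
  \<open>UNIV // circle_rel n\<close>, and it carries the quotient topology.\<close>

definition circle :: "nat \<Rightarrow> real set topology" where
  "circle n = topology (\<lambda>U. U \<subseteq> UNIV // circle_rel n \<and> open {x. circle_rel n `` {x} \<in> U})"

lemma openin_circle:
  "openin (circle n) U \<longleftrightarrow>
     U \<subseteq> UNIV // circle_rel n \<and> open {x. circle_rel n `` {x} \<in> U}"
proof -
  let ?P = "\<lambda>U. U \<subseteq> UNIV // circle_rel n \<and> open {x. circle_rel n `` {x} \<in> U}"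
  have "istopology ?P"
    unfolding istopology_def
  proof (intro conjI allI impI)
    fix S T assume S: "?P S" and T: "?P T"
    show "S \<inter> T \<subseteq> UNIV // circle_rel n" using S by blast
    have "{x. circle_rel n `` {x} \<in> S \<inter> T} =
        {x. circle_rel n `` {x} \<in> S} \<inter> {x. circle_rel n `` {x} \<in> T}" by blast
    then show "open {x. circle_rel n `` {x} \<in> S \<inter> T}" using S T by (simp add: open_Int)
  next
    fix K assume K: "\<forall>U\<in>K. ?P U"
    show "\<Union>K \<subseteq> UNIV // circle_rel n" using K by blast
    have "{x. circle_rel n `` {x} \<in> \<Union>K} = (\<Union>U\<in>K. {x. circle_rel n `` {x} \<in> U})" by blast
    then show "open {x. circle_rel n `` {x} \<in> \<Union>K}" using K by (simp add: open_UN)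
  qed
  then show ?thesis by (simp add: circle_def)
qed

definition torus :: "nat \<Rightarrow> nat \<Rightarrow> (nat \<Rightarrow> real set) topology" where
  "torus d n = product_topology (\<lambda>_. circle n) {..<d}"

definition point_factor :: "nat \<Rightarrow> int \<Rightarrow> real set set" where
  "point_factor n a = (\<lambda>x. circle_rel n `` {x}) ` {of_int a}"

definition interval_factor :: "nat \<Rightarrow> int \<Rightarrow> real set set" where
  "interval_factor n a = (\<lambda>x. circle_rel n `` {x}) ` {of_int a <..< of_int a + 1}"

text \<open>The open \<open>i\<close>-cubes of the lattice. The integers \<open>a t\<close> only matter modulo \<open>n\<close>,
  since congruent integers give the same factor.\<close>

definition open_cubes :: "nat \<Rightarrow> nat \<Rightarrow> nat \<Rightarrow> (nat \<Rightarrow> real set) set set" where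
  "open_cubes d n i =
     {(\<Pi>\<^sub>E t\<in>{..<d}. if t \<in> I then interval_factor n (a t) else point_factor n (a t)) | I a.
        I \<subseteq> {..<d} \<and> card I = i}"

definition cube_intrinsic_volume :: "nat \<Rightarrow> nat \<Rightarrow> real" where
  "cube_intrinsic_volume k i = (if k \<le> i then (-1) ^ (i - k) * real (i choose k) else 0)"

definition intrinsic_volume :: "nat \<Rightarrow> nat \<Rightarrow> nat \<Rightarrow> (nat \<Rightarrow> real set) set \<Rightarrow> real" where
  "intrinsic_volume d n k C =
     (\<Sum>i\<le>d. \<Sum>X | X \<in> open_cubes d n i \<and> X \<subseteq> C. cube_intrinsic_volume k i)"

text \<open>Distribution of the random complex: \<open>w X\<close> says whether the \<open>d\<close>-cube \<open>X\<close> is selected.\<close>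

definition voxel_model :: "nat \<Rightarrow> nat \<Rightarrow> real \<Rightarrow> (nat \<Rightarrow> real set) set pmf" where
  "voxel_model d n p =
     map_pmf (\<lambda>w. \<Union>X\<in>{X \<in> open_cubes d n d. w X}. torus d n closure_of X)
       (Pi_pmf (open_cubes d n d) False (\<lambda>_. bernoulli_pmf p))"

definition N_coeff :: "nat \<Rightarrow> nat \<Rightarrow> nat \<Rightarrow> real" where
  "N_coeff i j s =
     (\<Sum>l=0..s. (-1) ^ (s - l) * real (s choose l) * real (l choose i) * real (l choose j)
        * 2 powi (int s + int l - int i - int j))"

text \<open>The product \<open>q^(2^(d-i) + 2^(d-j)) * (q^(-2^(d-s)) - 1)\<close> is expanded into monomials.
  The truncated subtraction in the first exponent is harmless: where \<open>s < max i j\<close>,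
  the coefficient \<open>N_coeff i j s\<close> vanishes.\<close>

definition variance_poly :: "nat \<Rightarrow> nat \<Rightarrow> real poly" where
  "variance_poly d k =
     (\<Sum>i=0..d. \<Sum>j=0..d. \<Sum>s=0..d.
        smult ((-1) ^ (i + j) * real (i choose k) * real (j choose k) * real (d choose s)
                 * N_coeff i j s)
          (monom 1 (2 ^ (d - i) + 2 ^ (d - j) - 2 ^ (d - s)) - monom 1 (2 ^ (d - i) + 2 ^ (d - j))))"

end

theory Submission
  imports Defs
begin

text \<open>
  Encode a cube of the lattice by a function from coordinates to one-dimensional cells, and let its
  star be the set of adjacent top-dimensional cubes. A cube fails to lie in the complex exactly when
  nothing in its star is selected, so an \<open>i\<close>-cube and a \<open>j\<close>-cube whose stars have \<open>m\<close> common elements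
  contribute the covariance \<open>q ^ (2 ^ (d - i) + 2 ^ (d - j) - m) - q ^ (2 ^ (d - i) + 2 ^ (d - j))\<close>.
  Stars are products, so \<open>m\<close> is either \<open>0\<close> or \<open>2 ^ (d - s)\<close>, where \<open>s\<close> counts the coordinates in
  which the two cells have exactly one neighbouring interval in common. In one coordinate, up to
  translation, the pairs of cells with a common neighbour have the generating function
  \<open>1 + t (2 + 2 x + 2 y + x y)\<close>, where \<open>x\<close> and \<open>y\<close> mark intervals and \<open>t\<close> marks a single common
  neighbour; this is where \<open>n > 2\<close> enters. Since
  \<open>2 + 2 x + 2 y + x y = 4 (1 + x / 2) (1 + y / 2) - 2\<close>, the number \<open>N\<^sub>i\<^sub>j\<^sub>s\<close> is the coefficient of
  \<open>x ^ i y ^ j\<close> in its \<open>s\<close>-th power. These coefficients are nonnegative, which gives the degree.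
\<close>

subsection \<open>Cubes of the torus\<close>

definition circle_pt :: "nat \<Rightarrow> real \<Rightarrow> real set" where
  "circle_pt n x = circle_rel n `` {x}"

lemma equiv_circle_rel: "equiv UNIV (circle_rel n)"
proof (rule equivI)
  show "refl (circle_rel n)"
    by (auto simp: refl_on_def circle_rel_def intro: exI[of _ 0])
  show "sym (circle_rel n)"
  proof (rule symI)
    fix x y assume "(x, y) \<in> circle_rel n"
    then obtain m :: int where "y - x = of_int m * real n" by (auto simp: circle_rel_def)
    then have "x - y = of_int (- m) * real n" by simp
    then show "(y, x) \<in> circle_rel n" unfolding circle_rel_def by blast
  qed
  show "trans (circle_rel n)"
  proof (rule transI)
    fix x y z assume "(x, y) \<in> circle_rel n" "(y, z) \<in> circle_rel n"
    then obtain l m :: int where "y - x = of_int l * real n" "z - y = of_int m * real n"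
      by (auto simp: circle_rel_def)
    then have "z - x = of_int (l + m) * real n" by (simp add: algebra_simps)
    then show "(x, z) \<in> circle_rel n" unfolding circle_rel_def by blast
  qed
qed simp

lemma circle_pt_eq_iff: "circle_pt n x = circle_pt n y \<longleftrightarrow> (\<exists>m::int. y = x + of_int m * real n)"
proof -
  have "circle_pt n x = circle_pt n y \<longleftrightarrow> (x, y) \<in> circle_rel n"
    unfolding circle_pt_def by (rule eq_equiv_class_iff[OF equiv_circle_rel]) simp_all
  then show ?thesis by (simp add: circle_rel_def algebra_simps)
qed

lemma circle_pt_shift: "circle_pt n (x + of_int m * real n) = circle_pt n x"
  using circle_pt_eq_iff by metis

lemma circle_pt_in_image_iff:
  "circle_pt n x \<in> circle_pt n ` A \<longleftrightarrow> (\<exists>m::int. x + of_int m * real n \<in> A)"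
  by (auto simp: image_iff circle_pt_eq_iff)

lemma topspace_circle: "topspace (circle n) = range (circle_pt n)"
proof -
  have q: "UNIV // circle_rel n = range (circle_pt n)"
    by (auto simp: quotient_def circle_pt_def)
  have "openin (circle n) (UNIV // circle_rel n)"
    by (simp add: openin_circle quotientI)
  then have "UNIV // circle_rel n \<subseteq> topspace (circle n)" by (rule openin_subset)
  moreover have "topspace (circle n) \<subseteq> UNIV // circle_rel n"
    using openin_topspace[of "circle n"] unfolding openin_circle by blast
  ultimately show ?thesis using q by simp
qed

lemma openin_circle_pt:
  "openin (circle n) U \<longleftrightarrow> U \<subseteq> range (circle_pt n) \<and> open {x. circle_pt n x \<in> U}"
  by (auto simp: openin_circle circle_pt_def quotient_def)

text \<open>The preimage of the complement under the quotient map is the union of the open gaps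
  between consecutive translates of \<open>[a, a + 1]\<close> by multiples of \<open>n\<close>,
  hence open.\<close>

lemma closedin_circle_arc:
  assumes "n > 2"
  shows "closedin (circle n) (circle_pt n ` {of_int a..of_int a + 1})"
proof -
  let ?A = "{of_int a..of_int a + 1} :: real set"
  let ?U = "\<Union>m::int. {of_int a + 1 + of_int m * real n<..<of_int a + (of_int m + 1) * real n}"
  have n: "real n > 2" using assms by simp
  have "{x. circle_pt n x \<notin> circle_pt n ` ?A} = ?U"
  proof (intro set_eqI iffI)
    fix x assume "x \<in> {x. circle_pt n x \<notin> circle_pt n ` ?A}"
    then have out: "x + of_int m * real n \<notin> ?A" for m :: int
      by (auto simp: circle_pt_in_image_iff)
    \<comment> \<open>\<open>m\<close> numbers the period \<open>[a + m n, a + (m + 1) n)\<close>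
      containing \<open>x\<close>; avoiding the arc at the start of that period puts
      \<open>x\<close> into its gap.\<close>
    define m where "m = \<lfloor>(x - of_int a) / real n\<rfloor>"
    have "of_int m \<le> (x - of_int a) / real n" "(x - of_int a) / real n < of_int m + 1"
      unfolding m_def by linarith+
    then have "of_int m * real n \<le> x - of_int a" "x - of_int a < (of_int m + 1) * real n"
      using n by (simp_all add: pos_le_divide_eq pos_divide_less_eq)
    moreover have "x + of_int (- m) * real n \<notin> ?A" by (rule out)
    ultimately show "x \<in> ?U" by (auto simp: algebra_simps intro!: exI[of _ m])
  next
    fix x assume "x \<in> ?U"
    then obtain m :: int where m: "of_int a + 1 + of_int m * real n < x"
      "x < of_int a + (of_int m + 1) * real n" by auto
    \<comment> \<open>A translate of \<open>x\<close> in the arc would force the integer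
      \<open>m + l\<close> to lie strictly between -1 and 0.\<close>
    have "x + of_int l * real n \<notin> ?A" for l :: int
    proof
      assume "x + of_int l * real n \<in> ?A"
      then have l: "of_int a \<le> x + of_int l * real n" "x + of_int l * real n \<le> of_int a + 1"
        by auto
      have "of_int (m + l) * real n < 0" "of_int (m + l + 1) * real n > 0"
        using l m by (simp_all add: algebra_simps)
      then have "real_of_int (m + l) < 0" "real_of_int (m + l + 1) > 0"
        using n by (simp_all only: mult_less_0_iff zero_less_mult_iff) linarith+
      then have "m + l < 0" "m + l + 1 > 0"
        by (simp_all only: of_int_less_0_iff of_int_0_less_iff)
      then show False by linarith
    qed
    then show "x \<in> {x. circle_pt n x \<notin> circle_pt n ` ?A}"
      by (auto simp: circle_pt_in_image_iff)
  qed
  moreover have "open ?U" by auto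
  ultimately have "open {x. circle_pt n x \<in> range (circle_pt n) - circle_pt n ` ?A}" by simp
  then show ?thesis
    by (auto simp: closedin_def topspace_circle openin_circle_pt)
qed

lemma interval_factor_eq: "interval_factor n a = circle_pt n ` {of_int a<..<of_int a + 1}"
  and point_factor_eq: "point_factor n a = {circle_pt n (of_int a)}"
  by (auto simp: interval_factor_def point_factor_def circle_pt_def)

text \<open>The closed arc bounds the closure from above. Conversely, an open set around a point of
  the arc has an open preimage in the line, and this meets the open interval because the closed
  interval is its closure there.\<close>

lemma closure_interval_factor:
  assumes "n > 2"
  shows "circle n closure_of interval_factor n a = circle_pt n ` {of_int a..of_int a + 1}"
proof
  show "circle n closure_of interval_factor n a \<subseteq> circle_pt n ` {of_int a..of_int a + 1}"
    by (rule closure_of_minimal[OF _ closedin_circle_arc[OF assms]])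
      (auto simp: interval_factor_eq)
  show "circle_pt n ` {of_int a..of_int a + 1} \<subseteq> circle n closure_of interval_factor n a"
  proof
    fix y assume "y \<in> circle_pt n ` {of_int a..of_int a + 1}"
    then obtain x where x: "y = circle_pt n x" "x \<in> {of_int a..of_int a + 1}" by blast
    then have cl: "x \<in> closure {of_int a<..<of_int a + 1}" by simp
    show "y \<in> circle n closure_of interval_factor n a"
      unfolding in_closure_of
    proof (intro conjI allI impI)
      show "y \<in> topspace (circle n)" by (simp add: x topspace_circle)
      fix T assume T: "y \<in> T \<and> openin (circle n) T"
      then have "open {z. circle_pt n z \<in> T}" "x \<in> {z. circle_pt n z \<in> T}"
        by (auto simp: openin_circle_pt x)
      with cl have "{z. circle_pt n z \<in> T} \<inter> {of_int a<..<of_int a + 1} \<noteq> {}"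
        using open_Int_closure_eq_empty by blast
      then show "\<exists>z. z \<in> interval_factor n a \<and> z \<in> T"
        by (auto simp: interval_factor_eq)
    qed
  qed
qed

section \<open>One-dimensional cells of the circle and adjacency\<close>

definition cells :: "nat \<Rightarrow> (bool \<times> int) set" where
  "cells n = UNIV \<times> {0..<int n}"

definition factor :: "nat \<Rightarrow> bool \<times> int \<Rightarrow> real set set" where
  "factor n c = (if fst c then interval_factor n (snd c) else point_factor n (snd c))"

text \<open>The intervals having the cell as a face: for a point, the interval starting there and
  the one ending there, wrapped around at 0.\<close>

definition nbrs :: "nat \<Rightarrow> bool \<times> int \<Rightarrow> (bool \<times> int) set" where
  "nbrs n c = (if fst c then {c} else {(True, snd c), (True, (snd c - 1) mod int n)})"

lemma finite_cells: "finite (cells n)"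
  by (simp add: cells_def)

lemma nbrs_subset_cells: "n > 2 \<Longrightarrow> c \<in> cells n \<Longrightarrow> nbrs n c \<subseteq> cells n"
  by (cases c) (auto simp: nbrs_def cells_def)

lemma fst_nbrs: "e \<in> nbrs n c \<Longrightarrow> fst e"
  by (auto simp: nbrs_def split: if_splits)

lemma factor_nonempty: "factor n c \<noteq> {}"
  by (auto simp: factor_def interval_factor_eq point_factor_eq)

lemma residue_eqI:
  fixes a b m :: int
  assumes "a \<in> {0..<int n}" "b \<in> {0..<int n}" "a = b + m * int n"
  shows "a = b"
proof -
  have "a mod int n = b mod int n" by (simp add: assms(3))
  then show ?thesis using assms(1,2) by simp
qed

lemma factor_mod: "factor n (b, a mod int n) = factor n (b, a)"
proof -
  define m where "m = a div int n"
  have "a = a mod int n + m * int n" unfolding m_def by simp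
  then have a: "real_of_int a = of_int (a mod int n) + of_int m * real n"
    by (metis of_int_add of_int_mult of_int_of_nat_eq)
  have "circle_pt n ` {of_int (a mod int n)<..<of_int (a mod int n) + 1}
      = circle_pt n ` {of_int a<..<of_int a + 1}" (is "_ ` ?A = _ ` ?B")
  proof -
    have "?B = (\<lambda>x. x + of_int m * real n) ` ?A"
    proof (intro set_eqI iffI)
      fix x assume "x \<in> ?B"
      then show "x \<in> (\<lambda>x. x + of_int m * real n) ` ?A"
        by (intro image_eqI[of _ _ "x - of_int m * real n"]) (auto simp: a)
    qed (auto simp: a)
    then show ?thesis by (simp add: image_image circle_pt_shift)
  qed
  moreover have "circle_pt n (of_int (a mod int n)) = circle_pt n (of_int a)"
    by (simp add: a circle_pt_shift)
  ultimately show ?thesis by (simp add: factor_def interval_factor_eq point_factor_eq)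
qed

text \<open>A representative \<open>x\<close> of a point of the circle determines the cell: its
  floor gives the position, and integrality separates points from intervals. Another representative
  differs by a multiple of \<open>n\<close>, which preserves integrality and the residue of the
  floor.\<close>

lemma factor_disjoint:
  assumes "c \<in> cells n" "e \<in> cells n" "factor n c \<inter> factor n e \<noteq> {}"
  shows "c = e"
proof -
  have rep: "\<exists>x. y = circle_pt n x \<and> \<lfloor>x\<rfloor> = snd c \<and> (fst c \<longleftrightarrow> x \<notin> \<int>)" if y: "y \<in> factor n c" for y c
  proof (cases "fst c")
    case True
    then obtain x where x: "y = circle_pt n x" "of_int (snd c) < x" "x < of_int (snd c) + 1"
      using y by (auto simp: factor_def interval_factor_eq)
    then have "\<lfloor>x\<rfloor> = snd c" by linarith
    moreover have "x \<notin> \<int>"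
      using x by (auto elim!: Ints_cases)
    ultimately show ?thesis using x True by blast
  next
    case False
    then show ?thesis using y
      by (auto simp: factor_def point_factor_eq intro!: exI[of _ "of_int (snd c)"])
  qed
  obtain z where z: "z \<in> factor n c" "z \<in> factor n e" using assms(3) by blast
  from rep[OF z(1)] obtain x where x: "z = circle_pt n x" "\<lfloor>x\<rfloor> = snd c" "fst c \<longleftrightarrow> x \<notin> \<int>" by blast
  from rep[OF z(2)] obtain y where y: "z = circle_pt n y" "\<lfloor>y\<rfloor> = snd e" "fst e \<longleftrightarrow> y \<notin> \<int>" by blast
  have "circle_pt n x = circle_pt n y" using x(1) y(1) by simp
  then obtain m :: int where m: "y = x + of_int m * real n"
    unfolding circle_pt_eq_iff ..
  then have yx: "y = x + of_int (m * int n)" by simp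
  then have "\<lfloor>y\<rfloor> = \<lfloor>x\<rfloor> + m * int n" by (simp only: floor_add_int)
  then have "snd e = snd c + m * int n" using x(2) y(2) by simp
  then have "snd e = snd c"
    by (rule residue_eqI[rotated 2]) (use assms(1,2) in \<open>auto simp: cells_def\<close>)
  moreover have "y \<in> \<int> \<longleftrightarrow> x \<in> \<int>"
  proof
    assume "x \<in> \<int>"
    then show "y \<in> \<int>" unfolding yx by (intro Ints_add Ints_of_int)
  next
    assume "y \<in> \<int>"
    then have "y - of_int (m * int n) \<in> \<int>" by (intro Ints_diff Ints_of_int)
    then show "x \<in> \<int>" by (simp only: yx add_diff_cancel_right')
  qed
  ultimately show ?thesis using x(3) y(3) by (simp add: prod_eq_iff)
qed

lemma closure_factor:
  assumes "n > 2"
  shows "circle n closure_of factor n (True, a) =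
    factor n (True, a) \<union> factor n (False, a) \<union> factor n (False, (a + 1) mod int n)"
proof -
  have "{of_int a..of_int a + 1} = {of_int a<..<of_int a + 1} \<union> {of_int a :: real} \<union> {of_int (a + 1)}"
    by auto
  then have "circle_pt n ` {of_int a..of_int a + 1} =
      factor n (True, a) \<union> factor n (False, a) \<union> factor n (False, a + 1)"
    by (auto simp: factor_def interval_factor_eq point_factor_eq)
  then show ?thesis
    using closure_interval_factor[OF assms, of a] unfolding factor_mod by (simp add: factor_def)
qed

text \<open>Reads adjacency from the side of the interval instead of its face: predecessor and
  successor modulo \<open>n\<close> are inverse to each other.\<close>

lemma in_nbrs_iff:
  assumes "n > 2" "c \<in> cells n" "a \<in> {0..<int n}"
  shows "(True, a) \<in> nbrs n c \<longleftrightarrow> c \<in> {(True, a), (False, a), (False, (a + 1) mod int n)}"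
proof -
  obtain b where b: "snd c = b" "b \<in> {0..<int n}" using assms(2) by (auto simp: cells_def)
  have "a = (b - 1) mod int n \<longleftrightarrow> b = (a + 1) mod int n"
  proof
    assume "a = (b - 1) mod int n"
    then have "(a + 1) mod int n = (b - 1 + 1) mod int n" by (simp only: mod_add_left_eq)
    then show "b = (a + 1) mod int n" using b(2) by simp
  next
    assume "b = (a + 1) mod int n"
    then have "(b - 1) mod int n = (a + 1 - 1) mod int n" by (simp only: mod_diff_left_eq)
    then show "a = (b - 1) mod int n" using assms(3) by simp
  qed
  then show ?thesis using b(1) by (cases c) (auto simp: nbrs_def)
qed

text \<open>The closure of an interval is a union of cells and distinct cells are disjoint, so a
  cell that merely meets the closure is already contained in it.\<close>

lemma factor_closure:
  assumes "n > 2" "c \<in> cells n" "e \<in> cells n" "fst e"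
  shows "e \<in> nbrs n c \<Longrightarrow> factor n c \<subseteq> circle n closure_of factor n e"
    and "factor n c \<inter> circle n closure_of factor n e \<noteq> {} \<Longrightarrow> e \<in> nbrs n c"
proof -
  obtain a where e: "e = (True, a)" using assms(4) by (cases e) auto
  have a: "a \<in> {0..<int n}" using assms(3) by (auto simp: e cells_def)
  note iff = in_nbrs_iff[OF assms(1,2) a, folded e]
  show "factor n c \<subseteq> circle n closure_of factor n e" if "e \<in> nbrs n c"
    using that unfolding iff by (auto simp: e closure_factor[OF assms(1)])
  assume "factor n c \<inter> circle n closure_of factor n e \<noteq> {}"
  then obtain c' where c': "c' \<in> {(True, a), (False, a), (False, (a + 1) mod int n)}"
    and meet: "factor n c \<inter> factor n c' \<noteq> {}"
    unfolding e closure_factor[OF assms(1)] Int_Un_distrib by blast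
  have "c' \<in> cells n" using a c' by (auto simp: cells_def)
  then have "c = c'" using meet by (rule factor_disjoint[OF assms(2)])
  then show "e \<in> nbrs n c" using c' unfolding iff by (simp add: e)
qed

lemma inj_factor: "inj_on (factor n) (cells n)"
proof (rule inj_onI)
  fix c e assume *: "c \<in> cells n" "e \<in> cells n" "factor n c = factor n e"
  show "c = e" by (rule factor_disjoint[OF *(1,2)]) (simp add: *(3) factor_nonempty)
qed

section \<open>Cubes of the torus as functions into cells, and their stars\<close>

definition grid :: "nat \<Rightarrow> nat \<Rightarrow> (nat \<Rightarrow> bool \<times> int) set" where
  "grid d n = (\<Pi>\<^sub>E t\<in>{..<d}. cells n)"

definition cube :: "nat \<Rightarrow> nat \<Rightarrow> (nat \<Rightarrow> bool \<times> int) \<Rightarrow> (nat \<Rightarrow> real set) set" where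
  "cube d n f = (\<Pi>\<^sub>E t\<in>{..<d}. factor n (f t))"

definition star :: "nat \<Rightarrow> nat \<Rightarrow> (nat \<Rightarrow> bool \<times> int) \<Rightarrow> (nat \<Rightarrow> bool \<times> int) set" where
  "star d n f = (\<Pi>\<^sub>E t\<in>{..<d}. nbrs n (f t))"

definition cube_dim :: "nat \<Rightarrow> (nat \<Rightarrow> bool \<times> int) \<Rightarrow> nat" where
  "cube_dim d f = (\<Sum>t<d. of_bool (fst (f t)))"

lemma finite_grid: "finite (grid d n)"
  by (simp add: grid_def finite_PiE finite_cells)

lemma cube_dim_eq_card: "cube_dim d f = card {t \<in> {..<d}. fst (f t)}"
  by (simp add: cube_dim_def sum.If_cases of_bool_def Int_def)

lemma cube_dim_le: "cube_dim d f \<le> d"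
  using card_mono[of "{..<d}" "{t \<in> {..<d}. fst (f t)}"] by (auto simp: cube_dim_eq_card)

lemma cube_dim_eq_top_iff: "cube_dim d f = d \<longleftrightarrow> (\<forall>t<d. fst (f t))"
proof
  assume "cube_dim d f = d"
  then have "{t \<in> {..<d}. fst (f t)} = {..<d}"
    by (intro card_subset_eq) (auto simp: cube_dim_eq_card)
  then show "\<forall>t<d. fst (f t)" by auto
qed (simp add: cube_dim_def)

lemma inj_cube: "inj_on (cube d n) (grid d n)"
proof (rule inj_onI)
  fix f g assume fg: "f \<in> grid d n" "g \<in> grid d n" "cube d n f = cube d n g"
  then have "\<forall>t<d. factor n (f t) = factor n (g t)"
    by (auto simp: cube_def PiE_eq_iff factor_nonempty)
  then have "\<forall>t<d. f t = g t"
    using fg(1,2) inj_onD[OF inj_factor, of n] by (simp add: grid_def PiE_iff)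
  then show "f = g" using fg(1,2) unfolding grid_def by (auto intro: PiE_ext)
qed

text \<open>Reducing positions modulo \<open>n\<close> selects one code in \<open>grid\<close> for
  each cube, so sums over cubes become sums over a finite product.\<close>

lemma open_cubes_eq:
  assumes "n > 2"
  shows "open_cubes d n i = cube d n ` {f \<in> grid d n. cube_dim d f = i}"
proof (intro set_eqI iffI)
  fix X assume "X \<in> open_cubes d n i"
  then obtain I a where X: "X = (\<Pi>\<^sub>E t\<in>{..<d}. if t \<in> I then interval_factor n (a t) else point_factor n (a t))"
    "I \<subseteq> {..<d}" "card I = i" by (auto simp: open_cubes_def)
  define f where "f = (\<lambda>t\<in>{..<d}. (t \<in> I, a t mod int n))"
  have "X = cube d n f"
    unfolding X cube_def f_def by (intro PiE_cong) (auto simp: factor_mod, auto simp: factor_def)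
  moreover have "f \<in> grid d n" using assms by (auto simp: f_def grid_def cells_def)
  moreover have "{t \<in> {..<d}. fst (f t)} = I" using X(2) by (auto simp: f_def)
  ultimately show "X \<in> cube d n ` {f \<in> grid d n. cube_dim d f = i}"
    using X(3) by (auto simp: cube_dim_eq_card)
next
  fix X assume "X \<in> cube d n ` {f \<in> grid d n. cube_dim d f = i}"
  then obtain f where f: "X = cube d n f" "cube_dim d f = i" by blast
  have "X = (\<Pi>\<^sub>E t\<in>{..<d}. if t \<in> {t \<in> {..<d}. fst (f t)}
      then interval_factor n (snd (f t)) else point_factor n (snd (f t)))"
    unfolding f(1) cube_def by (intro PiE_cong) (auto simp: factor_def)
  then show "X \<in> open_cubes d n i"
    using f(2) unfolding open_cubes_def cube_dim_eq_card
    by (intro CollectI exI[of _ "{t \<in> {..<d}. fst (f t)}"] exI[of _ "\<lambda>t. snd (f t)"]) auto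
qed

lemma star_subset:
  assumes "n > 2" "f \<in> grid d n"
  shows "star d n f \<subseteq> {g \<in> grid d n. cube_dim d g = d}"
proof -
  have "star d n f \<subseteq> grid d n"
    unfolding star_def grid_def using assms nbrs_subset_cells
    by (intro PiE_mono) (auto simp: grid_def PiE_iff)
  moreover have "cube_dim d g = d" if "g \<in> star d n f" for g
    using that fst_nbrs unfolding star_def cube_dim_eq_top_iff PiE_iff by blast
  ultimately show ?thesis by blast
qed

text \<open>The closure of a product is the product of the closures, so being a face can be tested
  in each coordinate separately.\<close>

lemma cube_subset_voxel_iff:
  assumes n: "n > 2" and f: "f \<in> grid d n"
  shows "cube d n f \<subseteq> (\<Union>X\<in>{X \<in> open_cubes d n d. w X}. torus d n closure_of X)
    \<longleftrightarrow> (\<exists>g\<in>star d n f. w (cube d n g))"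
proof -
  have cl: "torus d n closure_of cube d n g = (\<Pi>\<^sub>E t\<in>{..<d}. circle n closure_of factor n (g t))" for g
    unfolding torus_def cube_def by (rule closure_of_product_topology)
  show ?thesis
  proof
    assume sub: "cube d n f \<subseteq> (\<Union>X\<in>{X \<in> open_cubes d n d. w X}. torus d n closure_of X)"
    \<comment> \<open>A single point suffices: it lies in the closure of one selected cube, and a
      cell that meets the closure of an interval is a face of it. This rules out a cube covered only
      jointly by several closures.\<close>
    have "cube d n f \<noteq> {}" by (simp add: cube_def PiE_eq_empty_iff factor_nonempty)
    then obtain x where x: "x \<in> cube d n f" by blast
    then obtain g where g: "g \<in> grid d n" "cube_dim d g = d" "w (cube d n g)"
      "x \<in> torus d n closure_of cube d n g"
      using sub by (auto simp: open_cubes_eq[OF n])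
    have "g t \<in> nbrs n (f t)" if "t < d" for t
    proof (rule factor_closure(2)[OF n])
      show "f t \<in> cells n" "g t \<in> cells n" using f g(1) that by (auto simp: grid_def)
      show "fst (g t)" using g(2) that by (simp add: cube_dim_eq_top_iff)
      have "x t \<in> factor n (f t)" using x that by (auto simp: cube_def)
      moreover have "x t \<in> circle n closure_of factor n (g t)" using g(4) that by (auto simp: cl)
      ultimately show "factor n (f t) \<inter> circle n closure_of factor n (g t) \<noteq> {}" by blast
    qed
    then have "g \<in> star d n f" using g(1) by (auto simp: star_def grid_def PiE_iff)
    then show "\<exists>g\<in>star d n f. w (cube d n g)" using g(3) by blast
  next
    assume "\<exists>g\<in>star d n f. w (cube d n g)"
    then obtain g where g: "g \<in> star d n f" "w (cube d n g)" by blast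
    then have g': "g \<in> grid d n" "cube_dim d g = d" using star_subset[OF n f] by auto
    have "cube d n f \<subseteq> torus d n closure_of cube d n g"
      unfolding cl unfolding cube_def
    proof (rule PiE_mono, rule factor_closure(1)[OF n])
      fix t assume t: "t \<in> {..<d}"
      show "f t \<in> cells n" "g t \<in> cells n" using f g'(1) t by (auto simp: grid_def)
      show "fst (g t)" using g'(2) t by (simp add: cube_dim_eq_top_iff)
      show "g t \<in> nbrs n (f t)" using g(1) t by (auto simp: star_def)
    qed
    then show "cube d n f \<subseteq> (\<Union>X\<in>{X \<in> open_cubes d n d. w X}. torus d n closure_of X)"
      using g' g(2) by (auto simp: open_cubes_eq[OF n])
  qed
qed

text \<open>Grouping the codes by dimension gives a weighted sum of indicators, the form needed for
  expanding the variance into covariances.\<close>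

lemma intrinsic_volume_eq:
  assumes "n > 2"
  shows "intrinsic_volume d n k C =
    (\<Sum>f\<in>grid d n. cube_intrinsic_volume k (cube_dim d f) * of_bool (cube d n f \<subseteq> C))"
proof -
  have "(\<Sum>X | X \<in> open_cubes d n i \<and> X \<subseteq> C. cube_intrinsic_volume k i)
      = (\<Sum>f | f \<in> grid d n \<and> cube_dim d f = i. cube_intrinsic_volume k (cube_dim d f) * of_bool (cube d n f \<subseteq> C))"
    (is "?l = ?r") for i
  proof -
    let ?A = "{f. f \<in> grid d n \<and> cube_dim d f = i}"
    have inj: "inj_on (cube d n) {f \<in> ?A. cube d n f \<subseteq> C}"
      by (rule inj_on_subset[OF inj_cube]) auto
    have "{X. X \<in> open_cubes d n i \<and> X \<subseteq> C} = cube d n ` {f \<in> ?A. cube d n f \<subseteq> C}"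
      by (auto simp: open_cubes_eq[OF assms])
    then have "?l = (\<Sum>f\<in>{f \<in> ?A. cube d n f \<subseteq> C}. cube_intrinsic_volume k i)"
      using inj by (simp add: card_image)
    also have "\<dots> = (\<Sum>f\<in>{f \<in> ?A. cube d n f \<subseteq> C}. cube_intrinsic_volume k (cube_dim d f) * of_bool (cube d n f \<subseteq> C))"
      by (rule sum.cong) auto
    also have "\<dots> = ?r"
      using finite_grid by (intro sum.mono_neutral_left) auto
    finally show ?thesis .
  qed
  then have "intrinsic_volume d n k C = (\<Sum>i\<le>d. \<Sum>f | f \<in> grid d n \<and> cube_dim d f = i.
      cube_intrinsic_volume k (cube_dim d f) * of_bool (cube d n f \<subseteq> C))"
    by (simp add: intrinsic_volume_def)
  also have "\<dots> = (\<Sum>f\<in>grid d n. cube_intrinsic_volume k (cube_dim d f) * of_bool (cube d n f \<subseteq> C))"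
    by (rule sum.group) (auto simp: finite_grid cube_dim_le)
  finally show ?thesis .
qed

subsection \<open>Counting pairs of cubes\<close>

lemma sum_PiE_lessThan_Suc:
  fixes F :: "(nat \<Rightarrow> 'a) \<Rightarrow> 'b::comm_monoid_add"
  shows "(\<Sum>f\<in>{..<Suc d} \<rightarrow>\<^sub>E S. F f) = (\<Sum>c\<in>S. \<Sum>f\<in>{..<d} \<rightarrow>\<^sub>E S. F (f(d := c)))"
proof -
  have "(\<Sum>f\<in>{..<Suc d} \<rightarrow>\<^sub>E S. F f) = (\<Sum>(c, f)\<in>S \<times> ({..<d} \<rightarrow>\<^sub>E S). F (f(d := c)))"
    unfolding lessThan_Suc PiE_insert_eq
    by (subst sum.reindex) (use inj_combinator[of d "{..<d}" "\<lambda>_. S"] in \<open>auto simp: case_prod_unfold\<close>)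
  then show ?thesis by (simp add: sum.cartesian_product)
qed

text \<open>Pascal's rule in summed form: with \<open>E\<close> the shift of \<open>g\<close>, it
  says \<open>(1 + E) ^ Suc s = (1 + E) ^ s (1 + E)\<close>.\<close>

lemma sum_choose_Suc:
  fixes g :: "nat \<Rightarrow> real"
  shows "(\<Sum>l\<le>Suc s. real (Suc s choose l) * g l) = (\<Sum>l\<le>s. real (s choose l) * (g l + g (Suc l)))"
proof -
  have "(\<Sum>l\<le>Suc s. real (Suc s choose l) * g l)
      = g 0 + (\<Sum>l\<le>s. real (s choose l) * g (Suc l)) + (\<Sum>l\<le>s. real (s choose Suc l) * g (Suc l))"
    by (simp add: sum.atMost_Suc_shift algebra_simps sum.distrib del: sum.atMost_Suc)
  \<comment> \<open>\<open>g 0\<close> and the last sum recombine into one sum up to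
    \<open>Suc s\<close>, whose top term is zero since \<open>s choose Suc s = 0\<close>.\<close>
  also have "g 0 + (\<Sum>l\<le>s. real (s choose l) * g (Suc l)) + (\<Sum>l\<le>s. real (s choose Suc l) * g (Suc l))
      = (\<Sum>l\<le>s. real (s choose l) * g (Suc l)) + (\<Sum>l\<le>Suc s. real (s choose l) * g l)"
    by (simp add: sum.atMost_Suc_shift del: sum.atMost_Suc)
  finally show ?thesis by (simp add: sum.distrib algebra_simps)
qed

text \<open>The next two sums apply the polynomials \<open>((1 + x / 2) (1 + y / 2)) ^ l\<close> and
  \<open>(4 (1 + x / 2) (1 + y / 2) - 2) ^ s\<close> to \<open>G\<close> and evaluate at \<open>(0, 0)\<close>, with \<open>x\<close> and \<open>y\<close> acting as
  the shifts of the two arguments of \<open>G\<close>.\<close>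

definition half_binomial_sum :: "nat \<Rightarrow> (nat \<Rightarrow> nat \<Rightarrow> real) \<Rightarrow> real" where
  "half_binomial_sum l G =
     (\<Sum>i\<le>l. real (l choose i) * (\<Sum>j\<le>l. real (l choose j) * (G i j / 2 ^ (i + j))))"

definition N_sum :: "nat \<Rightarrow> (nat \<Rightarrow> nat \<Rightarrow> real) \<Rightarrow> real" where
  "N_sum s G = (\<Sum>l\<le>s. real (s choose l) * ((-1) ^ (s - l) * 2 ^ (s + l) * half_binomial_sum l G))"

lemma half_binomial_sum_linear:
  "half_binomial_sum l (\<lambda>i j. G i j + H i j) = half_binomial_sum l G + half_binomial_sum l H"
  "half_binomial_sum l (\<lambda>i j. c * G i j) = c * half_binomial_sum l G"
  by (simp_all add: half_binomial_sum_def add_divide_distrib distrib_left sum.distrib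
      sum_distrib_left mult_ac)

lemma N_sum_linear:
  "N_sum s (\<lambda>i j. G i j + H i j) = N_sum s G + N_sum s H"
  "N_sum s (\<lambda>i j. c * G i j) = c * N_sum s G"
  by (simp_all add: N_sum_def half_binomial_sum_linear algebra_simps sum.distrib sum_distrib_left)

lemma half_binomial_sum_Suc:
  "half_binomial_sum (Suc l) G = half_binomial_sum l (\<lambda>i j. G i j + 1/2 * G (Suc i) j
     + 1/2 * G i (Suc j) + 1/4 * G (Suc i) (Suc j))"
  unfolding half_binomial_sum_def sum_choose_Suc
  by (intro sum.cong refl arg_cong2[where f = "(*)"])
    (auto simp: sum.distrib[symmetric] field_simps intro!: sum.cong)

text \<open>Multiplication by one more factor \<open>4 (1 + x / 2) (1 + y / 2) - 2\<close>, written
  out as \<open>2 + 2 x + 2 y + x y\<close>.\<close>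

lemma N_sum_Suc:
  "N_sum (Suc s) G = N_sum s (\<lambda>i j. 2 * G i j + 2 * G (Suc i) j + 2 * G i (Suc j) + G (Suc i) (Suc j))"
proof -
  \<comment> \<open>The factors 4 and -2 are the changes in
    \<open>(-1) ^ (s - l) * 2 ^ (s + l)\<close> when \<open>s\<close> grows by one together with
    \<open>l\<close> and without it.\<close>
  have step: "4 * half_binomial_sum (Suc l) G - 2 * half_binomial_sum l G =
      half_binomial_sum l (\<lambda>i j. 2 * G i j + 2 * G (Suc i) j + 2 * G i (Suc j) + G (Suc i) (Suc j))" for l
    unfolding half_binomial_sum_Suc half_binomial_sum_linear by simp
  have "N_sum (Suc s) G = (\<Sum>l\<le>s. real (s choose l) * ((-1) ^ (s - l) * 2 ^ (s + l) *
      (4 * half_binomial_sum (Suc l) G - 2 * half_binomial_sum l G)))"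
    unfolding N_sum_def sum_choose_Suc
    by (intro sum.cong) (auto simp: Suc_diff_le algebra_simps)
  then show ?thesis unfolding step N_sum_def .
qed

text \<open>Identifies \<open>N_coeff i j s\<close> as a coefficient of the \<open>s\<close>-th
  power. The binomials vanish past \<open>l\<close>, which allows the ranges of \<open>i\<close> and
  \<open>j\<close> to be extended to \<open>d\<close>.\<close>

lemma N_sum_eq:
  assumes "s \<le> d"
  shows "N_sum s G = (\<Sum>i\<le>d. \<Sum>j\<le>d. N_coeff i j s * G i j)"
proof -
  have U: "half_binomial_sum l G =
      (\<Sum>i\<le>d. \<Sum>j\<le>d. real (l choose i) * real (l choose j) * G i j / 2 ^ (i + j))" if "l \<le> s" for l
  proof -
    have "half_binomial_sum l G =
        (\<Sum>i\<le>d. real (l choose i) * (\<Sum>j\<le>d. real (l choose j) * (G i j / 2 ^ (i + j))))"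
      unfolding half_binomial_sum_def using that assms
      by (intro sum.mono_neutral_cong_left arg_cong2[where f = "(*)"] refl) auto
    then show ?thesis by (simp add: sum_distrib_left mult_ac)
  qed
  have p: "(2::real) powi (int s + int l - int i - int j) = 2 ^ (s + l) / 2 ^ (i + j)" for l i j
  proof -
    have "int s + int l - int i - int j = int (s + l) - int (i + j)" by simp
    then show ?thesis by (simp add: power_int_diff power_int_add power_add)
  qed
  have "N_sum s G = (\<Sum>l\<le>s. \<Sum>i\<le>d. \<Sum>j\<le>d. real (s choose l) * ((-1) ^ (s - l) * 2 ^ (s + l) *
      (real (l choose i) * real (l choose j) * G i j / 2 ^ (i + j))))"
    unfolding N_sum_def by (intro sum.cong refl) (simp add: U sum_distrib_left)
  also have "\<dots> = (\<Sum>i\<le>d. \<Sum>j\<le>d. \<Sum>l\<le>s. real (s choose l) * ((-1) ^ (s - l) * 2 ^ (s + l) *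
      (real (l choose i) * real (l choose j) * G i j / 2 ^ (i + j))))"
    by (subst sum.swap, rule sum.cong[OF refl], rule sum.swap)
  also have "\<dots> = (\<Sum>i\<le>d. \<Sum>j\<le>d. N_coeff i j s * G i j)"
    unfolding N_coeff_def p sum_distrib_right atMost_atLeast0
    by (intro sum.cong refl) (simp add: mult_ac)
  finally show ?thesis .
qed

text \<open>The alternating definition hides the sign, but the recursion \<open>N_sum_Suc\<close>
  has only positive coefficients, so \<open>N_sum\<close> preserves nonnegativity. Taking for
  \<open>G\<close> the indicator of the pair \<open>(i, j)\<close> extracts the coefficient.\<close>

lemma N_coeff_nonneg: "N_coeff i j s \<ge> 0"
proof -
  have nn: "N_sum s G \<ge> 0" if "\<And>i j. G i j \<ge> 0" for G
    using that
  proof (induction s arbitrary: G)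
    case 0
    then show ?case by (simp add: N_sum_def half_binomial_sum_def)
  next
    case (Suc s)
    show ?case unfolding N_sum_Suc by (rule Suc.IH) (simp add: Suc.prems)
  qed
  define d where "d = max s (max i j)"
  have "N_sum s (\<lambda>i' j'. of_bool (i' = i) * of_bool (j' = j)) = N_coeff i j s"
    by (subst N_sum_eq[of s d]) (auto simp: d_def sum_distrib_left[symmetric] mult.assoc[symmetric] sum_distrib_right[symmetric])
  then show ?thesis using nn[of "\<lambda>i' j'. of_bool (i' = i) * of_bool (j' = j)"] by simp
qed

text \<open>Only \<open>l = k\<close> survives, because \<open>l choose k\<close> vanishes for
  smaller \<open>l\<close>.\<close>

lemma N_coeff_diag: "N_coeff k k k = 1"
proof -
  have "N_coeff k k k = (\<Sum>l\<in>{k}. (-1) ^ (k - l) * real (k choose l) * real (l choose k) * real (l choose k)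
        * 2 powi (int k + int l - int k - int k))"
    unfolding N_coeff_def by (rule sum.mono_neutral_right) auto
  then show ?thesis by simp
qed

section \<open>Pairs with common neighbours, in one coordinate and then in all\<close>

lemma sum_cells:
  "(\<Sum>c\<in>cells n. F c) = (\<Sum>a\<in>{0..<int n}. F (False, a) + F (True, a))"
  for F :: "_ \<Rightarrow> real"
  by (simp add: cells_def sum.cartesian_product' UNIV_bool sum.distrib sum.swap)

text \<open>The generating function of one coordinate, with \<open>H\<close> in place of monomials.
  Its arguments tell whether each cell is an interval and whether exactly one neighbour is shared;
  the factor \<open>n\<close> counts the positions of the first cell.\<close>

lemma sum_cell_pairs:
  fixes H :: "bool \<Rightarrow> bool \<Rightarrow> bool \<Rightarrow> real"
  assumes n: "n > 2"
  shows "(\<Sum>c\<in>cells n. \<Sum>e\<in>cells n. if nbrs n c \<inter> nbrs n e \<noteq> {}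
      then H (fst c) (fst e) (card (nbrs n c \<inter> nbrs n e) = 1) else 0)
    = real n * (H False False False + 2 * H False False True + 2 * H True False True
        + 2 * H False True True + H True True True)"
proof -
  let ?R = "{0..<int n}"
  define s where "s a = (a + 1) mod int n" for a
  define p where "p a = (a - 1) mod int n" for a
  have s_eq: "s a = (if a + 1 = int n then 0 else a + 1)" if "a \<in> ?R" for a
    using that n by (auto simp: s_def)
  have p_eq: "p a = (if a = 0 then int n - 1 else a - 1)" if "a \<in> ?R" for a
    using that n by (auto simp: p_def zmod_minus1)
  have R: "s a \<in> ?R" "p a \<in> ?R" for a using n by (simp_all add: s_def p_def)
  \<comment> \<open>\<open>s a \<noteq> p a\<close> is the point where \<open>n > 2\<close> is
    essential: on a circle of length 2 both neighbours of a point coincide.\<close>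
  have sp: "s (p a) = a" "p (s a) = a" "s a \<noteq> a" "p a \<noteq> a" "s a \<noteq> p a" if "a \<in> ?R" for a
    using that n by (auto simp: s_eq p_eq R)
  have nb: "nbrs n (True, a) = {(True, a)}" "nbrs n (False, a) = {(True, a), (True, p a)}" for a
    by (simp_all add: nbrs_def p_def)
  let ?G = "\<lambda>c e. if nbrs n c \<inter> nbrs n e \<noteq> {}
      then H (fst c) (fst e) (card (nbrs n c \<inter> nbrs n e) = 1) else 0"
  \<comment> \<open>An interval shares a neighbour only with itself and its two endpoints.\<close>
  have "(\<Sum>e\<in>cells n. ?G (True, a) e) = H True True True + 2 * H True False True" if a: "a \<in> ?R" for a
  proof -
    have "(\<Sum>e\<in>cells n. ?G (True, a) e) = (\<Sum>e\<in>{(True, a), (False, a), (False, s a)}. ?G (True, a) e)"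
    proof (rule sum.mono_neutral_right[OF finite_cells], goal_cases)
      case 1 then show ?case using R a by (auto simp: cells_def)
    next
      case 2
      have "b = s a" if "b \<in> ?R" "p b = a" for b using sp(1)[OF that(1)] that(2) by metis
      then have "?G (True, a) (b', b) = 0" if "(b', b) \<in> cells n - {(True, a), (False, a), (False, s a)}"
        for b b' using that by (cases b') (auto simp: cells_def nb)
      then show ?case by (metis surj_pair)
    qed
    also have "\<dots> = H True True True + 2 * H True False True"
      using sp[OF a] by (auto simp: nb)
    finally show ?thesis .
  qed
  \<comment> \<open>A point shares two neighbours with itself, and one with each adjacent point and
    each of its two intervals.\<close>
  moreover have "(\<Sum>e\<in>cells n. ?G (False, a) e) =
      H False False False + 2 * H False False True + 2 * H False True True" if a: "a \<in> ?R" for a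
  proof -
    have "(\<Sum>e\<in>cells n. ?G (False, a) e) =
        (\<Sum>e\<in>{(False, a), (False, s a), (False, p a), (True, a), (True, p a)}. ?G (False, a) e)"
    proof (rule sum.mono_neutral_right[OF finite_cells], goal_cases)
      case 1 then show ?case using R a by (auto simp: cells_def)
    next
      case 2
      have "b = a" if "b \<in> ?R" "p b = p a" for b using sp(1)[OF a] sp(1)[OF that(1)] that(2) by metis
      moreover have "b = s a" if "b \<in> ?R" "p b = a" for b using sp(1)[OF that(1)] that(2) by metis
      ultimately have "?G (False, a) (b', b) = 0"
        if "(b', b) \<in> cells n - {(False, a), (False, s a), (False, p a), (True, a), (True, p a)}"
        for b b' using that by (cases b') (auto simp: cells_def nb)
      then show ?case by (metis surj_pair)
    qed
    also have "\<dots> = H False False False + 2 * H False False True + 2 * H False True True"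
    proof -
      \<comment> \<open>Otherwise the points \<open>a\<close> and \<open>p a\<close> would share
        both of their intervals.\<close>
      have "p (p a) \<noteq> a" using sp(1)[OF R(2)[of a]] sp(5)[OF a] by metis
      then have int: "nbrs n (False, a) \<inter> nbrs n (False, a) = {(True, a), (True, p a)}"
        "nbrs n (False, a) \<inter> nbrs n (False, s a) = {(True, a)}"
        "nbrs n (False, a) \<inter> nbrs n (False, p a) = {(True, p a)}"
        "nbrs n (False, a) \<inter> nbrs n (True, a) = {(True, a)}"
        "nbrs n (False, a) \<inter> nbrs n (True, p a) = {(True, p a)}"
        using sp[OF a] by (auto simp: nb)
      define g where "g = ?G (False, a)"
      have "g (False, a) = H False False False" "g (False, s a) = H False False True"
        "g (False, p a) = H False False True" "g (True, a) = H False True True"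
        "g (True, p a) = H False True True"
        unfolding g_def int using sp[OF a] by simp_all
      then have "(\<Sum>e\<in>{(False, a), (False, s a), (False, p a), (True, a), (True, p a)}. g e) =
          H False False False + 2 * H False False True + 2 * H False True True"
        using sp[OF a] by simp
      then show ?thesis unfolding g_def .
    qed
    finally show ?thesis .
  qed
  ultimately show ?thesis
    by (subst sum_cells) (simp add: algebra_simps)
qed

definition meets :: "nat \<Rightarrow> nat \<Rightarrow> (nat \<Rightarrow> bool \<times> int) \<Rightarrow> (nat \<Rightarrow> bool \<times> int) \<Rightarrow> bool" where
  "meets d n f g \<longleftrightarrow> (\<forall>t<d. nbrs n (f t) \<inter> nbrs n (g t) \<noteq> {})"

definition narrow :: "nat \<Rightarrow> nat \<Rightarrow> (nat \<Rightarrow> bool \<times> int) \<Rightarrow> (nat \<Rightarrow> bool \<times> int) \<Rightarrow> nat" where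
  "narrow d n f g = (\<Sum>t<d. of_bool (card (nbrs n (f t) \<inter> nbrs n (g t)) = 1))"

text \<open>The general weight \<open>F\<close> lets an induction on \<open>d\<close> absorb the
  shifts caused by the last coordinate. Pairs with disjoint stars are omitted since they are
  uncorrelated.\<close>

definition pair_sum :: "nat \<Rightarrow> nat \<Rightarrow> (nat \<Rightarrow> nat \<Rightarrow> nat \<Rightarrow> real) \<Rightarrow> real" where
  "pair_sum d n F = (\<Sum>f\<in>grid d n. \<Sum>g\<in>grid d n.
     if meets d n f g then F (cube_dim d f) (cube_dim d g) (narrow d n f g) else 0)"

text \<open>The last coordinate contributes the factor
  \<open>n (1 + t (2 + 2 x + 2 y + x y))\<close>, acting on \<open>F\<close> with \<open>x\<close>,
  \<open>y\<close>, \<open>t\<close> as shifts of its three arguments.\<close>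

lemma pair_sum_Suc:
  assumes n: "n > 2"
  shows "pair_sum (Suc d) n F = real n * pair_sum d n (\<lambda>i j s. F i j s + 2 * F i j (Suc s)
     + 2 * F (Suc i) j (Suc s) + 2 * F i (Suc j) (Suc s) + F (Suc i) (Suc j) (Suc s))"
proof -
  have upd: "cube_dim (Suc d) (f(d := c)) = cube_dim d f + of_bool (fst c)"
    "narrow (Suc d) n (f(d := c)) (g(d := e)) =
       narrow d n f g + of_bool (card (nbrs n c \<inter> nbrs n e) = 1)"
    "meets (Suc d) n (f(d := c)) (g(d := e)) \<longleftrightarrow> meets d n f g \<and> nbrs n c \<inter> nbrs n e \<noteq> {}"
    for f g c e
    by (auto simp: cube_dim_def narrow_def meets_def less_Suc_eq intro!: sum.cong)
  let ?H = "\<lambda>f g b b' o1. if meets d n f g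
      then F (cube_dim d f + of_bool b) (cube_dim d g + of_bool b') (narrow d n f g + of_bool o1) else 0"
  have "pair_sum (Suc d) n F = (\<Sum>c\<in>cells n. \<Sum>f\<in>grid d n. \<Sum>e\<in>cells n. \<Sum>g\<in>grid d n.
      if nbrs n c \<inter> nbrs n e \<noteq> {} then ?H f g (fst c) (fst e) (card (nbrs n c \<inter> nbrs n e) = 1) else 0)"
    unfolding pair_sum_def grid_def sum_PiE_lessThan_Suc upd
    by (intro sum.cong refl) auto
  \<comment> \<open>The sums over the last coordinates move inside, where
    \<open>sum_cell_pairs\<close> evaluates them for fixed \<open>f\<close> and
    \<open>g\<close>.\<close>
  also have "\<dots> = (\<Sum>f\<in>grid d n. \<Sum>g\<in>grid d n. \<Sum>c\<in>cells n. \<Sum>e\<in>cells n.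
      if nbrs n c \<inter> nbrs n e \<noteq> {} then ?H f g (fst c) (fst e) (card (nbrs n c \<inter> nbrs n e) = 1) else 0)"
    by (subst sum.swap, intro sum.cong refl, subst sum.swap, subst sum.swap[of _ "cells n" "grid d n"])
      (intro sum.cong refl sum.swap)
  also have "\<dots> = real n * pair_sum d n (\<lambda>i j s. F i j s + 2 * F i j (Suc s)
     + 2 * F (Suc i) j (Suc s) + 2 * F i (Suc j) (Suc s) + F (Suc i) (Suc j) (Suc s))"
    unfolding pair_sum_def sum_distrib_left
    by (intro sum.cong refl, subst sum_cell_pairs[OF n]) auto
  finally show ?thesis .
qed

text \<open>The binomial theorem for \<open>(1 + t P) ^ d\<close> with
  \<open>P = 2 + 2 x + 2 y + x y\<close>: \<open>d choose s\<close> selects the narrow coordinates,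
  and \<open>N_sum s\<close> applies \<open>P ^ s\<close>.\<close>

lemma pair_sum_eq:
  assumes n: "n > 2"
  shows "pair_sum d n F = real n ^ d * (\<Sum>s\<le>d. real (d choose s) * N_sum s (\<lambda>i j. F i j s))"
proof (induction d arbitrary: F)
  case 0
  show ?case
    by (simp add: pair_sum_def grid_def meets_def cube_dim_def narrow_def N_sum_def half_binomial_sum_def)
next
  case (Suc d)
  show ?case
    unfolding pair_sum_Suc[OF n] Suc.IH sum_choose_Suc N_sum_Suc
    by (simp add: N_sum_linear algebra_simps)
qed

subsection \<open>Variance and degree\<close>

lemma prod_one_or_two:
  assumes "\<And>t. t < d \<Longrightarrow> c t = (if P t then 1 else 2 :: nat)"
  shows "(\<Prod>t<d. c t) = 2 ^ (d - (\<Sum>t<d. of_bool (P t)))"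
  using assms
proof (induction d)
  case (Suc d)
  \<comment> \<open>This bound keeps the truncated subtraction in the exponent exact.\<close>
  have "(\<Sum>t<d. of_bool (P t)) \<le> (\<Sum>t<d. 1 :: nat)" by (rule sum_mono) simp
  then have "(\<Sum>t<d. of_bool (P t)) \<le> d" by simp
  then show ?case using Suc by (simp add: Suc_diff_le)
qed simp

lemma card_nbrs:
  assumes "n > 2" "c \<in> cells n"
  shows "card (nbrs n c) = (if fst c then 1 else 2)"
proof (cases "fst c")
  case False
  have "snd c \<noteq> (snd c - 1) mod int n"
  proof (cases "snd c = 0")
    case True
    then show ?thesis using assms by (simp add: zmod_minus1)
  next
    case False
    then have "(snd c - 1) mod int n = snd c - 1"
      using assms by (intro mod_pos_pos_trivial) (auto simp: cells_def)
    then show ?thesis by simp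
  qed
  then show ?thesis using False by (simp add: nbrs_def)
qed (simp add: nbrs_def)

lemma card_star:
  assumes "n > 2" "f \<in> grid d n"
  shows "card (star d n f) = 2 ^ (d - cube_dim d f)"
proof -
  have "card (nbrs n (f t)) = (if fst (f t) then 1 else 2)" if "t < d" for t
    using assms that by (intro card_nbrs) (auto simp: grid_def)
  then show ?thesis
    unfolding star_def cube_dim_def by (simp add: card_PiE prod_one_or_two)
qed

text \<open>The intersection is the product of the coordinatewise intersections. One empty factor
  makes it empty; otherwise every factor has size 1 or 2, and size 1 exactly at the narrow
  coordinates.\<close>

lemma card_star_Int:
  assumes "n > 2" "f \<in> grid d n" "g \<in> grid d n"
  shows "card (star d n f \<inter> star d n g) = (if meets d n f g then 2 ^ (d - narrow d n f g) else 0)"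
proof -
  let ?c = "\<lambda>t. card (nbrs n (f t) \<inter> nbrs n (g t))"
  have card_eq: "card (star d n f \<inter> star d n g) = (\<Prod>t<d. ?c t)"
    by (simp add: star_def PiE_Int card_PiE)
  have fin: "finite (nbrs n c)" for c by (simp add: nbrs_def)
  show ?thesis
  proof (cases "meets d n f g")
    case True
    have "?c t = (if ?c t = 1 then 1 else 2)" if t: "t < d" for t
    proof -
      have "?c t \<noteq> 0" using True t fin by (auto simp: meets_def)
      moreover have "?c t \<le> card (nbrs n (f t))" by (intro card_mono fin) auto
      moreover have "f t \<in> cells n" using assms(2) t by (auto simp: grid_def)
      then have "card (nbrs n (f t)) \<le> 2" using card_nbrs[OF assms(1)] by simp
      ultimately show ?thesis by simp
    qed
    then have "(\<Prod>t<d. ?c t) = 2 ^ (d - narrow d n f g)"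
      unfolding narrow_def by (rule prod_one_or_two)
    then show ?thesis using True card_eq by simp
  next
    case False
    then obtain t where "t < d" "nbrs n (f t) \<inter> nbrs n (g t) = {}" by (auto simp: meets_def)
    then have "(\<Prod>t<d. ?c t) = 0" by (intro prod_zero) (auto intro!: bexI[of _ t])
    then show ?thesis using False card_eq by simp
  qed
qed

section \<open>Covariances in the voxel model\<close>

lemma variance_sum_complement:
  fixes v :: "'b \<Rightarrow> real" and Z :: "'b \<Rightarrow> 'a \<Rightarrow> real"
  assumes "finite (set_pmf M)"
  shows "measure_pmf.variance M (\<lambda>w. \<Sum>x\<in>A. v x * (1 - Z x w)) =
    (\<Sum>x\<in>A. \<Sum>y\<in>A. v x * v y * (measure_pmf.expectation M (\<lambda>w. Z x w * Z y w)
       - measure_pmf.expectation M (Z x) * measure_pmf.expectation M (Z y)))"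
proof -
  let ?E = "measure_pmf.expectation M"
  have int [simp]: "integrable (measure_pmf M) h" for h :: "'a \<Rightarrow> real"
    using assms by (rule integrable_measure_pmf_finite)
  have mean: "?E (\<lambda>w. \<Sum>x\<in>A. v x * (1 - Z x w)) = (\<Sum>x\<in>A. v x * (1 - ?E (Z x)))"
    by simp
  \<comment> \<open>Centring turns \<open>1 - Z x\<close> into the negative of the centred
    \<open>Z x\<close>; the two signs cancel in each product, so the covariances are those of the
    \<open>Z x\<close>.\<close>
  have "((\<Sum>x\<in>A. v x * (1 - Z x w)) - (\<Sum>x\<in>A. v x * (1 - ?E (Z x))))\<^sup>2
      = (\<Sum>x\<in>A. \<Sum>y\<in>A. v x * v y * ((Z x w - ?E (Z x)) * (Z y w - ?E (Z y))))" for w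
  proof -
    have "(\<Sum>x\<in>A. v x * (1 - Z x w)) - (\<Sum>x\<in>A. v x * (1 - ?E (Z x)))
        = (\<Sum>x\<in>A. v x * (?E (Z x) - Z x w))"
      by (simp add: sum_subtractf[symmetric] algebra_simps)
    then show ?thesis
      by (simp only: power2_eq_square sum_product) (intro sum.cong refl, simp add: algebra_simps)
  qed
  then have "measure_pmf.variance M (\<lambda>w. \<Sum>x\<in>A. v x * (1 - Z x w)) =
      (\<Sum>x\<in>A. \<Sum>y\<in>A. v x * v y * ?E (\<lambda>w. (Z x w - ?E (Z x)) * (Z y w - ?E (Z y))))"
    unfolding mean by simp
  moreover have "?E (\<lambda>w. (Z x w - ?E (Z x)) * (Z y w - ?E (Z y))) = ?E (\<lambda>w. Z x w * Z y w) - ?E (Z x) * ?E (Z y)"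
    for x y
    by (simp add: algebra_simps)
  ultimately show ?thesis by simp
qed

text \<open>The indicator is a product of functions of single coordinates, constantly 1 outside
  \<open>B\<close>, so independence factors the expectation.\<close>

lemma expectation_none_selected:
  assumes "finite A" "B \<subseteq> A" "0 \<le> p" "p \<le> 1"
  shows "measure_pmf.expectation (Pi_pmf A False (\<lambda>_. bernoulli_pmf p))
    (\<lambda>w. of_bool (\<forall>x\<in>B. \<not> w x)) = (1 - p) ^ card B"
proof -
  define h where "h x b = (if x \<in> B \<and> b then 0 else 1 :: real)" for x :: 'a and b
  have "of_bool (\<forall>x\<in>B. \<not> w x) = (\<Prod>x\<in>A. h x (w x))" for w
    using assms(1,2) by (auto simp: h_def prod_zero_iff intro!: prod.neutral)
  then have "measure_pmf.expectation (Pi_pmf A False (\<lambda>_. bernoulli_pmf p)) (\<lambda>w. of_bool (\<forall>x\<in>B. \<not> w x))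
      = (\<Prod>x\<in>A. measure_pmf.expectation (bernoulli_pmf p) (h x))"
    by (simp only:)
      (rule expectation_prod_Pi_pmf[OF assms(1)], auto simp: h_def intro: integrable_measure_pmf_finite)
  also have "\<dots> = (\<Prod>x\<in>A. if x \<in> B then 1 - p else 1)"
    using assms(3,4) by (intro prod.cong refl) (simp add: h_def)
  also have "\<dots> = (1 - p) ^ card B"
    using assms(1,2) by (simp add: prod.If_cases Int_absorb1)
  finally show ?thesis .
qed

text \<open>The weighted covariance of two cubes of dimensions \<open>i\<close> and \<open>j\<close>
  whose stars meet, with \<open>s\<close> narrow coordinates; the first exponent is the size of the
  union of the stars.\<close>

definition term_value :: "nat \<Rightarrow> nat \<Rightarrow> real \<Rightarrow> nat \<Rightarrow> nat \<Rightarrow> nat \<Rightarrow> real" where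
  "term_value d k q i j s = cube_intrinsic_volume k i * cube_intrinsic_volume k j *
     (q ^ (2 ^ (d - i) + 2 ^ (d - j) - 2 ^ (d - s)) - q ^ (2 ^ (d - i) + 2 ^ (d - j)))"

text \<open>The variance is expanded in the absence indicators \<open>Z f\<close>, since absence of
  several cubes just means that nothing is selected in the union of their stars.\<close>

lemma variance_intrinsic_volume:
  assumes n: "n > 2" and p: "0 \<le> p" "p \<le> 1" and q: "q = 1 - p"
  shows "measure_pmf.variance (voxel_model d n p) (intrinsic_volume d n k) =
    pair_sum d n (term_value d k q)"
proof -
  let ?A = "open_cubes d n d"
  define M where "M = Pi_pmf ?A False (\<lambda>_. bernoulli_pmf p)"
  define B where "B f = cube d n ` star d n f" for f
  define Z where "Z f w = (of_bool (\<forall>X\<in>B f. \<not> w X) :: real)" for f and w :: "_ \<Rightarrow> bool"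
  define v where "v f = cube_intrinsic_volume k (cube_dim d f)" for f
  let ?U = "\<lambda>w. \<Union>X\<in>{X \<in> ?A. w X}. torus d n closure_of X"
  have finA: "finite ?A" by (simp add: open_cubes_eq[OF n] finite_grid)
  have finM: "finite (set_pmf M)"
  proof (rule finite_subset)
    show "set_pmf M \<subseteq> PiE_dflt ?A False (set_pmf \<circ> (\<lambda>_. bernoulli_pmf p))"
      unfolding M_def by (rule set_Pi_pmf_subset'[OF finA])
    show "finite (PiE_dflt ?A False (set_pmf \<circ> (\<lambda>_. bernoulli_pmf p)))"
      by (rule finite_PiE_dflt[OF finA]) simp
  qed
  have BA: "B f \<subseteq> ?A" if "f \<in> grid d n" for f
    unfolding B_def open_cubes_eq[OF n] using star_subset[OF n that] by blast
  have iv: "intrinsic_volume d n k (?U w) = (\<Sum>f\<in>grid d n. v f * (1 - Z f w))" for w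
    unfolding intrinsic_volume_eq[OF n] v_def
    by (intro sum.cong refl) (simp add: cube_subset_voxel_iff[OF n] Z_def B_def)
  have E1: "measure_pmf.expectation M (Z f) = q ^ card (B f)" if "f \<in> grid d n" for f
    unfolding M_def Z_def q by (rule expectation_none_selected[OF finA BA[OF that] p])
  have E2: "measure_pmf.expectation M (\<lambda>w. Z f w * Z g w) = q ^ card (B f \<union> B g)"
    if "f \<in> grid d n" "g \<in> grid d n" for f g
  proof -
    have "Z f w * Z g w = of_bool (\<forall>X\<in>B f \<union> B g. \<not> w X)" for w by (auto simp: Z_def)
    then show ?thesis
      unfolding M_def q using expectation_none_selected[OF finA _ p, of "B f \<union> B g"] BA that by simp
  qed
  \<comment> \<open>For disjoint stars the union has the sum of the two sizes, so the covariance is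
    0 and agrees with the pairs that \<open>pair_sum\<close> omits.\<close>
  have cov: "v f * v g * (q ^ card (B f \<union> B g) - q ^ card (B f) * q ^ card (B g)) =
      (if meets d n f g then term_value d k q (cube_dim d f) (cube_dim d g) (narrow d n f g) else 0)"
    if fg: "f \<in> grid d n" "g \<in> grid d n" for f g
  proof -
    \<comment> \<open>Selection is indexed by cubes and not by codes; injectivity transfers the
      cardinalities.\<close>
    have inj: "inj_on (cube d n) (star d n f \<union> star d n g)"
      using star_subset[OF n fg(1)] star_subset[OF n fg(2)] by (intro inj_on_subset[OF inj_cube]) blast
    have c: "card (B f) = 2 ^ (d - cube_dim d f)" "card (B g) = 2 ^ (d - cube_dim d g)"
      unfolding B_def using inj by (simp_all add: card_image inj_on_Un card_star[OF n] fg)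
    have "card (B f \<union> B g) = card (star d n f \<union> star d n g)"
      unfolding B_def image_Un[symmetric] by (rule card_image[OF inj])
    moreover have "finite (star d n f)" "finite (star d n g)"
      by (auto simp: star_def nbrs_def intro!: finite_PiE)
    then have "card (star d n f) + card (star d n g) =
        card (star d n f \<union> star d n g) + card (star d n f \<inter> star d n g)" by (rule card_Un_Int)
    ultimately have "card (B f \<union> B g) = 2 ^ (d - cube_dim d f) + 2 ^ (d - cube_dim d g) -
        (if meets d n f g then 2 ^ (d - narrow d n f g) else 0)"
      unfolding card_star_Int[OF n fg] card_star[OF n fg(1)] card_star[OF n fg(2)] by linarith
    then show ?thesis by (simp add: c term_value_def v_def power_add)
  qed
  have "measure_pmf.variance (voxel_model d n p) (intrinsic_volume d n k) =
      measure_pmf.variance M (\<lambda>w. \<Sum>f\<in>grid d n. v f * (1 - Z f w))"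
    unfolding voxel_model_def M_def[symmetric] by (simp add: iv)
  also have "\<dots> = pair_sum d n (term_value d k q)"
    unfolding variance_sum_complement[OF finM] pair_sum_def
    by (intro sum.cong refl) (simp only: E1 E2 cov)
  finally show ?thesis .
qed

section \<open>The variance polynomial: values and degree\<close>

lemma poly_variance_poly:
  "poly (variance_poly d k) q =
     (\<Sum>s\<le>d. real (d choose s) * N_sum s (\<lambda>i j. term_value d k q i j s))"
proof -
  \<comment> \<open>The exponents \<open>(i - k) + (j - k)\<close> and \<open>i + j\<close> have the
    same parity; if \<open>k\<close> exceeds \<open>i\<close> or \<open>j\<close>, both sides are
    0.\<close>
  have sign: "cube_intrinsic_volume k i * cube_intrinsic_volume k j =
      (-1) ^ (i + j) * real (i choose k) * real (j choose k)" for i j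
  proof (cases "k \<le> i \<and> k \<le> j")
    case True
    then obtain i' j' where "i = i' + k" "j = j' + k" by (metis le_Suc_ex add.commute)
    then show ?thesis
      by (simp add: cube_intrinsic_volume_def power_add power_mult_distrib[symmetric] algebra_simps)
  qed (auto simp: cube_intrinsic_volume_def)
  have "poly (variance_poly d k) q = (\<Sum>i\<le>d. \<Sum>j\<le>d. \<Sum>s\<le>d.
      real (d choose s) * (N_coeff i j s * term_value d k q i j s))"
    unfolding variance_poly_def term_value_def sign atMost_atLeast0
    by (simp add: poly_sum poly_monom mult_ac)
  also have "\<dots> = (\<Sum>s\<le>d. \<Sum>i\<le>d. \<Sum>j\<le>d.
      real (d choose s) * (N_coeff i j s * term_value d k q i j s))"
    by (rule trans[OF sum.cong[OF refl sum.swap] sum.swap])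
  also have "\<dots> = (\<Sum>s\<le>d. real (d choose s) * N_sum s (\<lambda>i j. term_value d k q i j s))"
    by (intro sum.cong refl) (simp add: N_sum_eq[of _ d] sum_distrib_left)
  finally show ?thesis .
qed

text \<open>Nonzero binomials require \<open>i, j \<ge> k\<close>, so no exponent exceeds
  \<open>2 ^ (d - k + 1)\<close>. This value is attained only by the subtracted monomial with
  \<open>i = j = k\<close>, and nonnegativity excludes cancellation over \<open>s\<close>.\<close>

lemma degree_variance_poly:
  assumes k: "k \<le> d"
  shows "degree (variance_poly d k) = 2 ^ (d - k + 1)"
proof -
  let ?D = "2 ^ (d - k + 1) :: nat"
  define K where "K = (\<Sum>s\<le>d. real (d choose s) * N_coeff k k s)"
  have coeff: "coeff (variance_poly d k) m = - of_bool (m = ?D) * K" if m: "m \<ge> ?D" for m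
  proof -
    have summand: "(-1) ^ (i + j) * real (i choose k) * real (j choose k) * real (d choose s) * N_coeff i j s *
        (of_bool (2 ^ (d - i) + 2 ^ (d - j) - 2 ^ (d - s) = m) - of_bool (2 ^ (d - i) + 2 ^ (d - j) = m))
      = (if i = k then if j = k then - of_bool (m = ?D) * (real (d choose s) * N_coeff k k s) else 0 else 0)"
      if "i \<le> d" "j \<le> d" for i j s
    proof (cases "k \<le> i \<and> k \<le> j")
      case True
      have le: "2 ^ (d - i) \<le> (2 ^ (d - k) :: nat)" "2 ^ (d - j) \<le> (2 ^ (d - k) :: nat)"
        using True by (simp_all add: diff_le_mono2)
      have D: "?D = 2 ^ (d - k) + 2 ^ (d - k)" by simp
      have pos: "(0::nat) < 2 ^ (d - s)" "(0::nat) < 2 ^ (d - k)" by simp_all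
      \<comment> \<open>Even if the subtraction truncates, the result 0 is still below
        \<open>m\<close>, because \<open>?D\<close> is positive.\<close>
      have e1: "2 ^ (d - i) + 2 ^ (d - j) - 2 ^ (d - s) \<noteq> m"
        using le D pos m by linarith
      show ?thesis
      proof (cases "i = k \<and> j = k")
        case True
        then show ?thesis using e1 by (auto simp: D mult_2)
      next
        case False
        have "2 ^ (d - i) < (2 ^ (d - k) :: nat) \<or> 2 ^ (d - j) < (2 ^ (d - k) :: nat)"
          using False True that by auto
        then have "2 ^ (d - i) + 2 ^ (d - j) \<noteq> m" using le D m by linarith
        then show ?thesis using e1 False by auto
      qed
    qed (auto simp: not_le)
    have "coeff (variance_poly d k) m = (\<Sum>i\<le>d. \<Sum>j\<le>d. \<Sum>s\<le>d.
        (-1) ^ (i + j) * real (i choose k) * real (j choose k) * real (d choose s) * N_coeff i j s *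
        (of_bool (2 ^ (d - i) + 2 ^ (d - j) - 2 ^ (d - s) = m) - of_bool (2 ^ (d - i) + 2 ^ (d - j) = m)))"
      unfolding variance_poly_def atMost_atLeast0
      by (simp add: coeff_sum of_bool_def)
    also have "\<dots> = (\<Sum>i\<le>d. \<Sum>j\<le>d. \<Sum>s\<le>d.
        (if i = k then if j = k then - of_bool (m = ?D) * (real (d choose s) * N_coeff k k s) else 0 else 0))"
      by (intro sum.cong refl summand) auto
    also have "\<dots> = (\<Sum>i\<le>d. \<Sum>j\<le>d. if i = k then if j = k then - of_bool (m = ?D) * K else 0 else 0)"
      unfolding K_def sum_distrib_left by (intro sum.cong refl) simp
    also have "\<dots> = (\<Sum>i\<le>d. if i = k then \<Sum>j\<le>d. if j = k then - of_bool (m = ?D) * K else 0 else 0)"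
      by (intro sum.cong refl) simp
    also have "\<dots> = - of_bool (m = ?D) * K" using k by simp
    finally show ?thesis .
  qed
  \<comment> \<open>The term \<open>s = k\<close> alone makes \<open>K\<close> positive, as all the
    others are nonnegative.\<close>
  have "0 < real (d choose k) * N_coeff k k k" using k by (simp add: N_coeff_diag)
  also have "\<dots> \<le> K"
    unfolding K_def by (rule member_le_sum) (use k in \<open>auto simp: N_coeff_nonneg\<close>)
  finally have "coeff (variance_poly d k) ?D \<noteq> 0" by (simp add: coeff)
  then have "?D \<le> degree (variance_poly d k)" by (rule le_degree)
  moreover have "degree (variance_poly d k) \<le> ?D"
    by (rule degree_le) (simp add: coeff)
  ultimately show ?thesis by (rule antisym[rotated])
qed

theorem theorem8:
  fixes d n k :: nat and p q :: real
  assumes "n > 2" and "k \<le> d" and "0 \<le> p" and "p \<le> 1" and "q = 1 - p"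
  shows "measure_pmf.variance (voxel_model d n p) (intrinsic_volume d n k) / real n ^ d
           = poly (variance_poly d k) q
       \<and> degree (variance_poly d k) = 2 ^ (d - k + 1)"
proof
  show "measure_pmf.variance (voxel_model d n p) (intrinsic_volume d n k) / real n ^ d
      = poly (variance_poly d k) q"
    unfolding variance_intrinsic_volume[OF assms(1,3-5)] pair_sum_eq[OF assms(1)] poly_variance_poly
    using assms(1) by simp
  show "degree (variance_poly d k) = 2 ^ (d - k + 1)"
    by (rule degree_variance_poly[OF assms(2)])
qed

end
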